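(* For $n\ge1$, let $K\subseteq\mathbb{R}^n$ be the set of all $\mu=(\mu_1,\ldots,\mu_n)$ of the form $$\mu_i=\alpha n^{-1/4}+\alpha\theta_i n^{-1/2},\qquad i=1,\ldots,n,$$ where $\alpha\in[0,1]$ and $\theta_1,\ldots,\theta_n\in[-1,1]$. Then $K$ is closed and convex. Moreover, let $Z$ be an $n$-dimensional standard Gaussian random vector, and for $\mu\in K$ let $Y:=Z+\mu$, let $\hat\mu:=P_K(Y)$, and let $\tilde\mu$ be the vector in $\mathbb{R}^n$ whose coordinates are all equal to the average $\frac1n\sum_{i=1}^n Y_i$ of the coordinates of $Y$. Then there are positive constants $C_1$ and $C_2$ that do not depend on $n$ such that $$\sup_{\mu\in K}\mathbb{E}\|\hat\mu-\mu\|^2\ge C_1 n^{1/2}\qquad\text{and}\qquad \sup_{\mu\in K}\mathbb{E}\|\tilde\mu-\mu\|^2\le C_2 .$$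
   Context: $\|\cdot\|$ is the Euclidean norm on $\mathbb{R}^n$; $P_K(x)$ denotes the unique point of the closed convex set $K$ closest to $x$ in Euclidean distance. *)

theory Defs
  imports "HOL-Probability.Probability"
begin

text \<open>
  The constants in the main result must not depend on \<open>n\<close>, so the dimension has to be an
  ordinary natural number. A vector in \<open>n\<close>-dimensional space is therefore an extensional
  function on \<open>{..<n}\<close> (coordinates are numbered from \<open>0\<close>). This is both
  the underlying set of the topology \<^term>\<open>powertop_real {..<n}\<close>, which is the
  usual topology, and the underlying set of the product measure on \<open>{..<n}\<close>.
\<close>

definition Rn :: "nat \<Rightarrow> (nat \<Rightarrow> real) set" where
  "Rn n = {..<n} \<rightarrow>\<^sub>E UNIV"

definition vadd :: "nat \<Rightarrow> (nat \<Rightarrow> real) \<Rightarrow> (nat \<Rightarrow> real) \<Rightarrow> (nat \<Rightarrow> real)" where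
  "vadd n x y = (\<lambda>i\<in>{..<n}. x i + y i)"

definition vdiff :: "nat \<Rightarrow> (nat \<Rightarrow> real) \<Rightarrow> (nat \<Rightarrow> real) \<Rightarrow> (nat \<Rightarrow> real)" where
  "vdiff n x y = (\<lambda>i\<in>{..<n}. x i - y i)"

definition vscale :: "nat \<Rightarrow> real \<Rightarrow> (nat \<Rightarrow> real) \<Rightarrow> (nat \<Rightarrow> real)" where
  "vscale n c x = (\<lambda>i\<in>{..<n}. c * x i)"

definition vnorm :: "nat \<Rightarrow> (nat \<Rightarrow> real) \<Rightarrow> real" where
  "vnorm n x = L2_set x {..<n}"

definition closed_Rn :: "nat \<Rightarrow> (nat \<Rightarrow> real) set \<Rightarrow> bool" where
  "closed_Rn n S \<longleftrightarrow> closedin (powertop_real {..<n}) S"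

definition convex_Rn :: "nat \<Rightarrow> (nat \<Rightarrow> real) set \<Rightarrow> bool" where
  "convex_Rn n S \<longleftrightarrow>
     S \<subseteq> Rn n \<and>
     (\<forall>x\<in>S. \<forall>y\<in>S. \<forall>u\<ge>0. \<forall>v\<ge>0. u + v = 1 \<longrightarrow> vadd n (vscale n u x) (vscale n v y) \<in> S)"

text \<open>Meaningful when \<open>S\<close> is nonempty, closed and convex, so that the nearest point
  exists and is unique.\<close>

definition proj_Rn :: "nat \<Rightarrow> (nat \<Rightarrow> real) set \<Rightarrow> (nat \<Rightarrow> real) \<Rightarrow> (nat \<Rightarrow> real)" where
  "proj_Rn n S x = (THE p. p \<in> S \<and> (\<forall>q\<in>S. vnorm n (vdiff n x p) \<le> vnorm n (vdiff n x q)))"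

definition K :: "nat \<Rightarrow> (nat \<Rightarrow> real) set" where
  "K n = {\<mu> \<in> Rn n. \<exists>\<alpha>\<in>{0..1}. \<exists>\<theta>::nat \<Rightarrow> real.
            (\<forall>i<n. \<theta> i \<in> {-1..1}) \<and>
            (\<forall>i<n. \<mu> i = \<alpha> * real n powr (- 1/4) + \<alpha> * \<theta> i * real n powr (- 1/2))}"

text \<open>The law of a vector with \<open>n\<close> independent standard normal coordinates.\<close>

definition std_gaussian :: "nat \<Rightarrow> (nat \<Rightarrow> real) measure" where
  "std_gaussian n = (\<Pi>\<^sub>M i\<in>{..<n}. density lborel std_normal_density)"

definition mean_vec :: "nat \<Rightarrow> (nat \<Rightarrow> real) \<Rightarrow> (nat \<Rightarrow> real)" where
  "mean_vec n y = (\<lambda>i\<in>{..<n}. (1 / real n) * (\<Sum>j<n. y j))"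

text \<open>
  Mean squared error at \<open>\<mu>\<close> of an estimator \<open>T\<close> applied to
  \<open>Y = Z + \<mu>\<close> with \<open>Z\<close> standard Gaussian. It is taken in the extended nonnegative
  reals, so that neither the expectation nor a supremum over \<open>\<mu>\<close> can
  degenerate to a default value.
\<close>

definition risk ::
  "nat \<Rightarrow> ((nat \<Rightarrow> real) \<Rightarrow> (nat \<Rightarrow> real)) \<Rightarrow> (nat \<Rightarrow> real) \<Rightarrow> ennreal" where
  "risk n T \<mu> = (\<integral>\<^sup>+ z. ennreal ((vnorm n (vdiff n (T (vadd n z \<mu>)) \<mu>))\<^sup>2) \<partial>std_gaussian n)"

end

theory Submission
  imports Defs
begin

text \<open>
  Write \<open>r = n\<^sup>1\<^sup>/\<^sup>4\<close>, so that the two scales in the definition of \<open>K\<close> are \<open>1/r\<close> and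
  \<open>1/r\<^sup>2\<close>, the target rate is \<open>r\<^sup>2\<close>, and \<open>n = r\<^sup>4\<close>.

  The existential description of \<open>K\<close> hides that \<open>K\<close> is a polytope. As \<open>1/r \<ge> 1/r\<^sup>2\<close>, the
  smallest \<open>\<alpha>\<close> compatible with the upper bounds on the coordinates of a point is also the best
  one for the lower bounds. Eliminating \<open>\<alpha>\<close> leaves finitely many linear inequalities, from which
  closedness, convexity and compactness are immediate (\<open>K_iff_inequalities\<close>).

  The sample mean is good because every point of \<open>K\<close> is within \<open>1/r\<^sup>2 = n\<^sup>-\<^sup>1\<^sup>/\<^sup>2\<close> of a constant vector
  in each coordinate: the squared bias is bounded by a constant, and so is the variance
  (\<open>risk_mean_le\<close>).

  The projection is bad at \<open>\<mu> = 0\<close>. Let \<open>w\<close> be the point of \<open>K\<close> with \<open>\<alpha> = 1\<close> and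
  \<open>\<theta>\<^sub>i\<close> the sign of \<open>z\<^sub>i\<close>, and let \<open>X = \<langle>z, w\<rangle> = (\<Sum> z\<^sub>i)/r + (\<Sum> \<bar>z\<^sub>i\<bar>)/r\<^sup>2\<close>. The noise is strongly
  correlated with \<open>w\<close>: the mean of \<open>X\<close> is of order \<open>r\<^sup>2\<close>, although \<open>w\<close> has norm of order only
  \<open>r\<close>. Let \<open>p\<close> be the projection of \<open>z\<close>. The variational inequality for \<open>p\<close> in the direction
  \<open>w\<close> says \<open>X \<le> \<langle>z, p\<rangle> + \<langle>p, w\<rangle>\<close>. The term \<open>\<langle>z, p\<rangle>\<close> is at most \<open>\<alpha> X\<close>, where \<open>\<alpha>\<close> is the
  parameter of \<open>p\<close>, and for \<open>r \<ge> 2\<close> the parameter \<open>\<alpha>\<close> is controlled by the average of the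
  coordinates of \<open>p\<close>. Hence \<open>X \<le> \<langle>p, v\<rangle>\<close> for a vector \<open>v\<close> with \<open>\<parallel>v\<parallel>\<^sup>2\<close> of order \<open>r\<^sup>2\<close> in mean,
  which forces \<open>\<parallel>p\<parallel>\<^sup>2\<close> to be of order \<open>r\<^sup>2\<close>. For \<open>r < 2\<close> the vector \<open>v = z + w\<close> will do.

  Instead of Cauchy--Schwarz under the expectation, the argument uses the pointwise inequality
  \<open>\<parallel>p\<parallel>\<^sup>2 \<ge> 2 l X - l\<^sup>2 \<parallel>v\<parallel>\<^sup>2\<close> with a fixed number \<open>l\<close> (\<open>projection_norm_lower_bound\<close>). Its right
  side is bounded below by a polynomial in \<open>\<Sum> z\<^sub>i\<close>, \<open>\<Sum> \<bar>z\<^sub>i\<bar>\<close> and \<open>\<Sum> z\<^sub>i\<^sup>2\<close>, whose mean follows from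
  the first and second moments of the standard normal distribution.
\<close>

section \<open>Nearest points in compact convex sets\<close>

lemma vnorm_power2: "(vnorm n x)\<^sup>2 = (\<Sum>i<n. (x i)\<^sup>2)"
  by (simp add: vnorm_def L2_set_def sum_nonneg)

lemma vnorm_le_iff: "vnorm n x \<le> vnorm n y \<longleftrightarrow> (\<Sum>i<n. (x i)\<^sup>2) \<le> (\<Sum>i<n. (y i)\<^sup>2)"
  by (simp add: vnorm_def L2_set_def)

text \<open>
  If the inner product \<open>c\<close> were positive, then moving from \<open>p\<close> towards \<open>q\<close> by a fraction \<open>t\<close>
  would change the squared distance to \<open>y\<close> by \<open>t\<^sup>2 d - 2 t c\<close>, which is negative for small \<open>t\<close>.
\<close>

lemma nearest_point_variational:
  assumes cvx: "convex_Rn n S" and p: "p \<in> S" and q: "q \<in> S"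
    and near: "\<And>s. s \<in> S \<Longrightarrow> vnorm n (vdiff n y p) \<le> vnorm n (vdiff n y s)"
  shows "(\<Sum>i<n. (y i - p i) * (q i - p i)) \<le> 0"
proof (rule ccontr)
  define c where "c = (\<Sum>i<n. (y i - p i) * (q i - p i))"
  define d where "d = (\<Sum>i<n. (q i - p i)\<^sup>2)"
  assume "\<not> ?thesis"
  then have c: "c > 0" by (simp add: c_def)
  have d: "d \<ge> 0" by (simp add: d_def sum_nonneg)
  \<comment> \<open>This fraction lies in \<open>(0, 1]\<close> and satisfies \<open>t d < 2 c\<close> even if \<open>d = 0\<close>.\<close>
  define t where "t = c / (c + d)"
  have t: "0 < t" "t \<le> 1" using c d by (auto simp: t_def)
  have "vadd n (vscale n (1 - t) p) (vscale n t q) \<in> S"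
    using cvx p q t by (auto simp: convex_Rn_def)
  from near[OF this]
  have "(\<Sum>i<n. (y i - p i)\<^sup>2) \<le> (\<Sum>i<n. (y i - ((1 - t) * p i + t * q i))\<^sup>2)"
    by (simp add: vnorm_le_iff vdiff_def vadd_def vscale_def)
  also have "\<dots> = (\<Sum>i<n. (y i - p i)\<^sup>2 - 2 * t * ((y i - p i) * (q i - p i)) + t\<^sup>2 * (q i - p i)\<^sup>2)"
    by (intro sum.cong refl) (simp add: power2_eq_square algebra_simps)
  also have "\<dots> = (\<Sum>i<n. (y i - p i)\<^sup>2) - 2 * t * c + t\<^sup>2 * d"
    by (simp add: c_def d_def sum.distrib sum_subtractf sum_distrib_left)
  finally have "t * (2 * c) \<le> t * (t * d)" by (simp add: power2_eq_square mult_ac)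
  then have "2 * c \<le> t * d" using t by simp
  also have "t * d \<le> c" using c d by (simp add: t_def field_simps)
  finally show False using c by simp
qed

text \<open>
  Compactness gives existence of the nearest point. Uniqueness, needed to unfold the definite
  description, comes from adding the variational inequalities of two nearest points, each in the
  direction of the other: the sum of the left sides is their squared distance.
\<close>

lemma proj_Rn_variational:
  assumes cpt: "compactin (powertop_real {..<n}) S" and ne: "S \<noteq> {}" and cvx: "convex_Rn n S"
  shows "proj_Rn n S y \<in> S"
    and "q \<in> S \<Longrightarrow> (\<Sum>i<n. (y i - proj_Rn n S y i) * (q i - proj_Rn n S y i)) \<le> 0"
proof -
  define f where "f = (\<lambda>x::nat \<Rightarrow> real. \<Sum>i<n. (y i - x i)\<^sup>2)"
  have "continuous_map (powertop_real {..<n}) euclideanreal f"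
    unfolding f_def
    by (intro continuous_intros continuous_map_real_pow) auto
  then have "compact (f ` S)"
    using image_compactin[OF cpt, of euclideanreal f] by simp
  then obtain p where p: "p \<in> S" "\<And>q. q \<in> S \<Longrightarrow> f p \<le> f q"
    using compact_attains_inf[of "f ` S"] ne by auto
  define P where "P = (\<lambda>p. p \<in> S \<and> (\<forall>q\<in>S. vnorm n (vdiff n y p) \<le> vnorm n (vdiff n y q)))"
  have Pp: "P p"
    using p by (simp add: P_def vnorm_le_iff vdiff_def f_def)
  have "p' = p" if "P p'" for p'
  proof -
    have "(\<Sum>i<n. (y i - p i) * (p' i - p i)) \<le> 0" "(\<Sum>i<n. (y i - p' i) * (p i - p' i)) \<le> 0"
      using that Pp by (auto simp: P_def intro!: nearest_point_variational[OF cvx])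
    then have "(\<Sum>i<n. (y i - p i) * (p' i - p i)) + (\<Sum>i<n. (y i - p' i) * (p i - p' i)) \<le> 0"
      by simp
    also have "(\<Sum>i<n. (y i - p i) * (p' i - p i)) + (\<Sum>i<n. (y i - p' i) * (p i - p' i))
        = (\<Sum>i<n. (p' i - p i)\<^sup>2)"
      unfolding sum.distrib[symmetric]
      by (intro sum.cong refl) (simp add: power2_eq_square algebra_simps)
    finally have "(\<Sum>i<n. (p' i - p i)\<^sup>2) = 0"
      using sum_nonneg[of "{..<n}" "\<lambda>i. (p' i - p i)\<^sup>2"] by (intro order_antisym) auto
    then have "\<forall>i<n. p' i = p i"
      by (simp add: sum_nonneg_eq_0_iff)
    moreover have "p \<in> Rn n" "p' \<in> Rn n"
      using that Pp cvx by (auto simp: P_def convex_Rn_def)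
    ultimately show ?thesis
      unfolding Rn_def by (intro PiE_ext[of p' "{..<n}" _ p]) auto
  qed
  then have "P (THE p. P p)"
    using Pp theI[of P p] by blast
  then have *: "P (proj_Rn n S y)"
    by (simp add: proj_Rn_def P_def)
  then show "proj_Rn n S y \<in> S"
    by (simp add: P_def)
  show "(\<Sum>i<n. (y i - proj_Rn n S y i) * (q i - proj_Rn n S y i)) \<le> 0" if "q \<in> S"
    using * that by (intro nearest_point_variational[OF cvx]) (auto simp: P_def)
qed

section \<open>The set K as a polytope\<close>

text \<open>
  All powers of \<open>n\<close> in the problem are integer powers of \<open>r = n\<^sup>1\<^sup>/\<^sup>4\<close>, so in terms of \<open>r\<close> the
  inequalities become polynomial.
\<close>

lemma fourth_root:
  fixes n :: nat
  assumes "n \<ge> 1"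
  obtains r :: real where "r \<ge> 1" "real n = r ^ 4" "real n powr (- 1/4) = 1 / r"
    "real n powr (- 1/2) = 1 / r\<^sup>2" "real n powr (1/2) = r\<^sup>2"
proof
  let ?r = "real n powr (1/4)"
  show "?r \<ge> 1" using assms by (simp add: ge_one_powr_ge_zero)
  show "real n = ?r ^ 4" using assms by (simp add: powr_power)
  show "real n powr (- 1/4) = 1 / ?r" by (simp add: powr_minus_divide)
  show "real n powr (1/2) = ?r\<^sup>2" using assms by (simp add: powr_power)
  then show "real n powr (- 1/2) = 1 / ?r\<^sup>2" by (simp add: powr_minus_divide)
qed

text \<open>
  With \<open>a = 1/r\<close> and \<open>b = 1/r\<^sup>2\<close>, a point is in \<open>K\<close> iff some \<open>\<alpha> \<in> [0,1]\<close> satisfies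
  \<open>\<alpha>(a - b) \<le> x\<^sub>i \<le> \<alpha>(a + b)\<close> for all \<open>i\<close>. Since \<open>a - b \<ge> 0\<close>, the smallest \<open>\<alpha>\<close> allowed by the
  upper bounds, \<open>max\<^sub>i x\<^sub>i / (a + b)\<close>, makes the lower bounds easiest to satisfy; inserting it
  eliminates \<open>\<alpha>\<close>.
\<close>

lemma K_iff_inequalities:
  fixes r :: real
  assumes n: "n \<ge> 1" and r: "r \<ge> 1" "real n powr (- 1/4) = 1 / r" "real n powr (- 1/2) = 1 / r\<^sup>2"
  shows "x \<in> K n \<longleftrightarrow> x \<in> Rn n \<and> (\<forall>i<n. 0 \<le> x i \<and> x i \<le> 1 / r + 1 / r\<^sup>2) \<and>
    (\<forall>i<n. \<forall>j<n. (1 / r - 1 / r\<^sup>2) * x j \<le> (1 / r + 1 / r\<^sup>2) * x i)"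
    (is "_ \<longleftrightarrow> _ \<and> ?B \<and> ?R")
proof -
  define a where "a = 1 / r"
  define b where "b = 1 / r\<^sup>2"
  have b: "0 < b" "b \<le> a"
    using r by (auto simp: a_def b_def field_simps power2_eq_square)
  have K: "x \<in> K n \<longleftrightarrow> x \<in> Rn n \<and> (\<exists>\<alpha>\<in>{0..1}. \<exists>\<theta>. (\<forall>i<n. \<theta> i \<in> {-1..1}) \<and>
      (\<forall>i<n. x i = \<alpha> * a + \<alpha> * \<theta> i * b))"
    unfolding K_def r a_def b_def by simp
  show ?thesis
  proof
    assume "x \<in> K n"
    then obtain \<alpha> \<theta> where x: "x \<in> Rn n" and \<alpha>: "0 \<le> \<alpha>" "\<alpha> \<le> 1"
      and \<theta>: "\<forall>i<n. \<theta> i \<in> {-1..1}" and eq: "\<forall>i<n. x i = \<alpha> * a + \<alpha> * \<theta> i * b"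
      using K by auto
    have *: "\<alpha> * (a - b) \<le> x i \<and> x i \<le> \<alpha> * (a + b)" if "i < n" for i
    proof -
      have "(\<alpha> * b) * (-1) \<le> (\<alpha> * b) * \<theta> i" "(\<alpha> * b) * \<theta> i \<le> (\<alpha> * b) * 1"
        using \<theta> that \<alpha> b by (intro mult_left_mono; simp)+
      then show ?thesis using eq that by (simp add: algebra_simps)
    qed
    have "0 \<le> \<alpha> * (a - b)" "\<alpha> * (a + b) \<le> a + b"
      using \<alpha> b by (auto simp: mult_left_le_one_le)
    then have "?B" unfolding a_def[symmetric] b_def[symmetric] using * by force
    moreover have "(a - b) * x j \<le> (a + b) * x i" if "i < n" "j < n" for i j
    proof -
      have "(a - b) * x j \<le> (a - b) * (\<alpha> * (a + b))"
        using * that b by (intro mult_left_mono) auto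
      also have "\<dots> = (a + b) * (\<alpha> * (a - b))" by simp
      also have "\<dots> \<le> (a + b) * x i"
        using * that b by (intro mult_left_mono) auto
      finally show ?thesis .
    qed
    ultimately show "x \<in> Rn n \<and> ?B \<and> ?R"
      using x by (simp add: a_def b_def)
  next
    assume asm: "x \<in> Rn n \<and> ?B \<and> ?R"
    have fin: "finite (x ` {..<n})" "x ` {..<n} \<noteq> {}" using n by (auto simp: lessThan_empty_iff)
    define \<alpha> where "\<alpha> = Max (x ` {..<n}) / (a + b)"
    obtain m where m: "m < n" "Max (x ` {..<n}) = x m"
      using Max_in[OF fin] by auto
    have m': "x i \<le> x m" if "i < n" for i
      using Max_ge[OF fin(1), of "x i"] that m by simp
    have \<alpha>: "\<alpha> * (a + b) = x m" "\<alpha> = x m / (a + b)"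
      using b by (auto simp: \<alpha>_def m)
    have \<alpha>01: "0 \<le> \<alpha>" "\<alpha> \<le> 1"
      using asm m b unfolding \<alpha>(2) a_def[symmetric] b_def[symmetric] by auto
    have low: "\<alpha> * (a - b) \<le> x i" if "i < n" for i
      using asm m that b unfolding \<alpha>(2) a_def[symmetric] b_def[symmetric] by (simp add: field_simps)
    \<comment> \<open>If \<open>\<alpha> = 0\<close> then \<open>x\<close> vanishes on all coordinates, and any \<open>\<theta>\<close> is a witness.\<close>
    define \<theta> where "\<theta> = (\<lambda>i. if \<alpha> = 0 then 0 else (x i / \<alpha> - a) / b)"
    have "\<theta> i \<in> {-1..1} \<and> x i = \<alpha> * a + \<alpha> * \<theta> i * b" if "i < n" for i
    proof (cases "\<alpha> = 0")
      case True
      then have "x i \<le> 0" using m' that \<alpha> by fastforce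
      moreover have "0 \<le> x i" using asm that by blast
      ultimately show ?thesis using True by (simp add: \<theta>_def)
    next
      case False
      then have "\<alpha> > 0" using \<alpha>01 by simp
      then show ?thesis
        using low[OF that] m'[OF that] \<alpha>(1) b by (simp add: \<theta>_def field_simps)
    qed
    then show "x \<in> K n"
      unfolding K using asm \<alpha>01 by (intro conjI bexI[of _ \<alpha>] exI[of _ \<theta>]) auto
  qed
qed

lemma closed_K:
  assumes "n \<ge> 1"
  shows "closed_Rn n (K n)"
proof -
  obtain r :: real where r: "r \<ge> 1" "real n powr (- 1/4) = 1 / r" "real n powr (- 1/2) = 1 / r\<^sup>2"
    using fourth_root[OF assms] by metis
  define a b where "a = 1 / r - 1 / r\<^sup>2" and "b = 1 / r + 1 / r\<^sup>2"
  let ?T = "powertop_real {..<n}"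
  have top: "topspace ?T = Rn n" by (simp add: Rn_def)
  have "closedin ?T {x \<in> topspace ?T. x i \<in> {0..b}}" if "i < n" for i
    using that by (intro closedin_continuous_map_preimage[where Y = euclideanreal] continuous_intros) auto
  moreover have "closedin ?T {x \<in> topspace ?T. b * x i - a * x j \<in> {0..}}" if "i < n" "j < n" for i j
    using that by (intro closedin_continuous_map_preimage[where Y = euclideanreal] continuous_intros) auto
  ultimately have closed: "closedin ?T (topspace ?T \<inter> (\<Inter>i<n. {x \<in> topspace ?T. x i \<in> {0..b}}) \<inter>
      (\<Inter>i<n. \<Inter>j<n. {x \<in> topspace ?T. b * x i - a * x j \<in> {0..}}))"
    using assms by (intro closedin_Int closedin_topspace closedin_INT) (auto simp: lessThan_empty_iff)
  have "K n = topspace ?T \<inter> (\<Inter>i<n. {x \<in> topspace ?T. x i \<in> {0..b}}) \<inter>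
      (\<Inter>i<n. \<Inter>j<n. {x \<in> topspace ?T. b * x i - a * x j \<in> {0..}})"
    unfolding top by (intro set_eqI, unfold K_iff_inequalities[OF assms r, folded a_def b_def]) auto
  with closed show ?thesis
    by (simp only: closed_Rn_def)
qed

lemma convex_K:
  assumes "n \<ge> 1"
  shows "convex_Rn n (K n)"
proof -
  obtain r :: real where r: "r \<ge> 1" "real n powr (- 1/4) = 1 / r" "real n powr (- 1/2) = 1 / r\<^sup>2"
    using fourth_root[OF assms] by metis
  define a b where "a = 1 / r - 1 / r\<^sup>2" and "b = 1 / r + 1 / r\<^sup>2"
  note K = K_iff_inequalities[OF assms r, folded a_def b_def]
  show ?thesis
    unfolding convex_Rn_def
  proof (intro conjI ballI allI impI)
    show "K n \<subseteq> Rn n" by (auto simp: K_def)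
    fix x y and u v :: real
    assume x: "x \<in> K n" and y: "y \<in> K n" and uv: "u \<ge> 0" "v \<ge> 0" "u + v = 1"
    have "u * x i + v * y i \<le> u * b + v * b" if "i < n" for i
      using x y uv that by (intro add_mono mult_left_mono) (auto simp: K)
    then have "u * x i + v * y i \<le> b" if "i < n" for i
      using uv that by (metis distrib_right mult_1)
    moreover have "a * (u * x j + v * y j) \<le> b * (u * x i + v * y i)" if "i < n" "j < n" for i j
    proof -
      have "u * (a * x j) + v * (a * y j) \<le> u * (b * x i) + v * (b * y i)"
        using x y uv that by (intro add_mono mult_left_mono) (auto simp: K)
      then show ?thesis by (simp add: algebra_simps)
    qed
    ultimately show "vadd n (vscale n u x) (vscale n v y) \<in> K n"
      using x y uv by (auto simp: K vadd_def vscale_def Rn_def)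
  qed
qed

lemma compact_K:
  assumes "n \<ge> 1"
  shows "compactin (powertop_real {..<n}) (K n)"
proof -
  obtain r :: real where r: "r \<ge> 1" "real n powr (- 1/4) = 1 / r" "real n powr (- 1/2) = 1 / r\<^sup>2"
    using fourth_root[OF assms] by metis
  show ?thesis
  proof (rule closed_compactin)
    show "compactin (powertop_real {..<n}) (PiE {..<n} (\<lambda>_. {0..1 / r + 1 / r\<^sup>2}))"
      by (simp add: compactin_PiE)
    show "K n \<subseteq> PiE {..<n} (\<lambda>_. {0..1 / r + 1 / r\<^sup>2})"
      by (intro subsetI) (simp add: K_iff_inequalities[OF assms r] Rn_def PiE_iff)
  qed (use closed_K[OF assms] in \<open>simp add: closed_Rn_def\<close>)
qed

text \<open>
  The form in which membership in \<open>K\<close> is used for risk bounds: coordinates vary around \<open>\<alpha>/r\<close> only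
  on the smaller scale, with a variation proportional to the same \<open>\<alpha>\<close>.
\<close>

lemma K_deviation:
  fixes r :: real
  assumes n: "n \<ge> 1" and r: "r \<ge> 1" "real n powr (- 1/4) = 1 / r" "real n powr (- 1/2) = 1 / r\<^sup>2" 
    and "x \<in> K n"
  obtains \<alpha> where "0 \<le> \<alpha>" "\<alpha> \<le> 1" "\<And>i. i < n \<Longrightarrow> \<bar>x i - \<alpha> / r\<bar> \<le> \<alpha> / r\<^sup>2"
proof -
  obtain \<alpha> \<theta> where \<alpha>: "0 \<le> \<alpha>" "\<alpha> \<le> 1"
    and \<theta>: "\<forall>i<n. \<theta> i \<in> {-1..1}" and eq: "\<forall>i<n. x i = \<alpha> / r + \<alpha> / r\<^sup>2 * \<theta> i"
    using \<open>x \<in> K n\<close> unfolding K_def r by auto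
  have "\<bar>\<alpha> / r\<^sup>2 * \<theta> i\<bar> \<le> \<alpha> / r\<^sup>2 * 1" if "i < n" for i
    unfolding abs_mult using \<theta> that \<alpha> by (intro mult_mono) auto
  then show ?thesis using \<alpha> eq by (intro that[of \<alpha>]) auto
qed

section \<open>Moments of the Gaussian vector\<close>

abbreviation "gauss \<equiv> density lborel std_normal_density"

lemma gauss_moments:
  shows "prob_space gauss"
    and "integrable gauss (\<lambda>x. x)" "(\<integral>x. x \<partial>gauss) = 0"
    and "integrable gauss (\<lambda>x. x\<^sup>2)" "(\<integral>x. x\<^sup>2 \<partial>gauss) = 1"
    and "integrable gauss (\<lambda>x. \<bar>x\<bar>)" "(\<integral>x. \<bar>x\<bar> \<partial>gauss) = sqrt (2 / pi)"
proof -
  show "prob_space gauss"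
    by (rule prob_space_normal_density) simp
  show "integrable gauss (\<lambda>x. x)" "(\<integral>x. x \<partial>gauss) = 0"
    using std_normal_moment_odd[of 0]
    by (auto simp: integrable_density integral_density has_bochner_integral_iff)
  show "integrable gauss (\<lambda>x. x\<^sup>2)" "(\<integral>x. x\<^sup>2 \<partial>gauss) = 1"
    using std_normal_moment_even[of 1]
    by (auto simp: integrable_density integral_density has_bochner_integral_iff)
  show "integrable gauss (\<lambda>x. \<bar>x\<bar>)" "(\<integral>x. \<bar>x\<bar> \<partial>gauss) = sqrt (2 / pi)"
    using std_normal_moment_abs_odd[of 0]
    by (auto simp: integrable_density integral_density has_bochner_integral_iff)
qed

lemma prob_space_std_gaussian: "prob_space (std_gaussian n)"
  unfolding std_gaussian_def by (intro prob_space_PiM gauss_moments)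

lemma std_gaussian_coordinate:
  fixes f :: "real \<Rightarrow> real"
  assumes i: "i < n" and f: "integrable gauss f"
  shows "integrable (std_gaussian n) (\<lambda>z. f (z i))"
    and "(\<integral>z. f (z i) \<partial>std_gaussian n) = (\<integral>x. f x \<partial>gauss)"
proof -
  have distr: "distr (std_gaussian n) gauss (\<lambda>z. z i) = gauss"
    unfolding std_gaussian_def using i gauss_moments(1)
    by (intro distr_PiM_component) auto
  have m: "(\<lambda>z. z i) \<in> measurable (std_gaussian n) gauss"
    unfolding std_gaussian_def using i by (intro measurable_component_singleton) auto
  have fm: "f \<in> borel_measurable gauss" using f by auto
  show "integrable (std_gaussian n) (\<lambda>z. f (z i))"
    using f integrable_distr_eq[OF m fm] distr by simp
  show "(\<integral>z. f (z i) \<partial>std_gaussian n) = (\<integral>x. f x \<partial>gauss)"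
    using integral_distr[OF m fm] distr by simp
qed

text \<open>
  Fubini for products of one-variable functions applies once \<open>z\<^sub>i z\<^sub>j\<close> is written as a product over
  all coordinates, with the constant function \<open>1\<close> in the remaining ones.
\<close>

lemma std_gaussian_product:
  assumes "i < n" "j < n" "i \<noteq> j"
  shows "integrable (std_gaussian n) (\<lambda>z. z i * z j)"
    and "(\<integral>z. z i * z j \<partial>std_gaussian n) = 0"
proof -
  interpret product_prob_space "\<lambda>_. gauss" "{..<n}"
    using gauss_moments(1) by (simp add: product_prob_space_def product_prob_space_axioms_def
      product_sigma_finite_def prob_space_imp_sigma_finite)
  define f :: "nat \<Rightarrow> real \<Rightarrow> real" where "f = (\<lambda>k x. if k \<in> {i, j} then x else 1)"
  have prod: "(\<Prod>k<n. f k (z k)) = z i * z j" for z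
  proof -
    have "(\<Prod>k<n. f k (z k)) = (\<Prod>k\<in>{..<n} \<inter> {i, j}. z k)"
      by (subst prod.inter_restrict) (auto simp: f_def)
    also have "{..<n} \<inter> {i, j} = {i, j}" using assms by auto
    finally show ?thesis using assms by simp
  qed
  have int: "integrable gauss (f k)" for k
    using gauss_moments(2) by (cases "k \<in> {i, j}") 
      (auto simp: f_def intro!: finite_measure.integrable_const prob_space.finite_measure gauss_moments(1))
  have zero: "(\<Prod>k<n. \<integral>x. f k x \<partial>gauss) = 0"
    using assms gauss_moments(3) by (intro prod_zero) (auto simp: f_def intro!: bexI[of _ i])
  show "integrable (std_gaussian n) (\<lambda>z. z i * z j)"
    using product_integrable_prod[of "{..<n}" f] int by (simp add: prod std_gaussian_def)
  show "(\<integral>z. z i * z j \<partial>std_gaussian n) = 0"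
    using product_integral_prod[of "{..<n}" f] int zero by (simp add: prod std_gaussian_def)
qed

lemma std_gaussian_sum:
  shows "integrable (std_gaussian n) (\<lambda>z. \<Sum>i<n. z i)" "(\<integral>z. (\<Sum>i<n. z i) \<partial>std_gaussian n) = 0"
    and "integrable (std_gaussian n) (\<lambda>z. \<Sum>i<n. (z i)\<^sup>2)" "(\<integral>z. (\<Sum>i<n. (z i)\<^sup>2) \<partial>std_gaussian n) = n"
    and "integrable (std_gaussian n) (\<lambda>z. \<Sum>i<n. \<bar>z i\<bar>)"
      "(\<integral>z. (\<Sum>i<n. \<bar>z i\<bar>) \<partial>std_gaussian n) = n * sqrt (2 / pi)"
    and "integrable (std_gaussian n) (\<lambda>z. (\<Sum>i<n. z i)\<^sup>2)"
      "(\<integral>z. (\<Sum>i<n. z i)\<^sup>2 \<partial>std_gaussian n) = n"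
proof -
  note c1 = std_gaussian_coordinate[OF _ gauss_moments(2), unfolded gauss_moments(3)]
  note c2 = std_gaussian_coordinate[OF _ gauss_moments(4), unfolded gauss_moments(5)]
  note c3 = std_gaussian_coordinate[OF _ gauss_moments(6), unfolded gauss_moments(7)]
  show "integrable (std_gaussian n) (\<lambda>z. \<Sum>i<n. z i)" "(\<integral>z. (\<Sum>i<n. z i) \<partial>std_gaussian n) = 0"
    using c1 by (auto simp: integral_sum)
  show "integrable (std_gaussian n) (\<lambda>z. \<Sum>i<n. (z i)\<^sup>2)" "(\<integral>z. (\<Sum>i<n. (z i)\<^sup>2) \<partial>std_gaussian n) = n"
    using c2 by (auto simp: integral_sum)
  show "integrable (std_gaussian n) (\<lambda>z. \<Sum>i<n. \<bar>z i\<bar>)"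
      "(\<integral>z. (\<Sum>i<n. \<bar>z i\<bar>) \<partial>std_gaussian n) = n * sqrt (2 / pi)"
    using c3 by (auto simp: integral_sum)
  have ij: "integrable (std_gaussian n) (\<lambda>z. z i * z j) \<and>
      (\<integral>z. z i * z j \<partial>std_gaussian n) = (if i = j then 1 else 0)" if "i < n" "j < n" for i j
    using that std_gaussian_product c2[of i n] by (auto simp: power2_eq_square)
  have sq: "(\<Sum>i<n. z i)\<^sup>2 = (\<Sum>i<n. \<Sum>j<n. z i * z j)" for z :: "nat \<Rightarrow> real"
    by (simp add: power2_eq_square sum_product)
  show "integrable (std_gaussian n) (\<lambda>z. (\<Sum>i<n. z i)\<^sup>2)"
    unfolding sq using ij by (intro Bochner_Integration.integrable_sum) auto
  have "(\<integral>z. (\<Sum>i<n. z i)\<^sup>2 \<partial>std_gaussian n) = (\<Sum>i<n. \<Sum>j<n. \<integral>z. z i * z j \<partial>std_gaussian n)"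
    unfolding sq using ij
    by (subst Bochner_Integration.integral_sum; (intro Bochner_Integration.integrable_sum sum.cong refl Bochner_Integration.integral_sum)?) auto
  also have "\<dots> = (\<Sum>i<n. \<Sum>j<n. if i = j then 1 else 0)"
    using ij by (intro sum.cong refl) auto
  also have "\<dots> = n" by simp
  finally show "(\<integral>z. (\<Sum>i<n. z i)\<^sup>2 \<partial>std_gaussian n) = n" .
qed

text \<open>
  Truncating the minorant \<open>g\<close> at \<open>0\<close> only increases its integral. In the application \<open>f\<close> is the
  squared error of the projection, and the minorant is negative for some values of the noise.
\<close>

lemma ennreal_integral_le_nn_integral:
  assumes "integrable M g" "\<And>x. g x \<le> f x"
  shows "ennreal (\<integral>x. g x \<partial>M) \<le> (\<integral>\<^sup>+x. ennreal (f x) \<partial>M)"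
proof -
  have "ennreal (\<integral>x. g x \<partial>M) \<le> ennreal (\<integral>x. max 0 (g x) \<partial>M)"
    using assms(1) by (intro ennreal_leI integral_mono) auto
  also have "\<dots> = (\<integral>\<^sup>+x. ennreal (max 0 (g x)) \<partial>M)"
    using assms(1) by (intro nn_integral_eq_integral[symmetric]) auto
  also have "\<dots> = (\<integral>\<^sup>+x. ennreal (g x) \<partial>M)"
    by (simp add: max.commute ennreal_max_0')
  also have "\<dots> \<le> (\<integral>\<^sup>+x. ennreal (f x) \<partial>M)"
    using assms(2) by (intro nn_integral_mono ennreal_leI) auto
  finally show ?thesis .
qed

section \<open>The risk of the sample mean\<close>

text \<open>
  With \<open>S = \<Sum> z\<^sub>i\<close> and \<open>m\<close> the average of the coordinates of \<open>\<mu>\<close>, the error in coordinate \<open>i\<close> is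
  \<open>S/n + (m - \<mu>\<^sub>i)\<close>. Both \<open>m\<close> and \<open>\<mu>\<^sub>i\<close> are within \<open>1/r\<^sup>2\<close> of \<open>\<alpha>/r\<close>, so the squared bias is at
  most \<open>4/n\<close> in each coordinate. The total squared error is thus at most \<open>2 S\<^sup>2/n + 8\<close>, whose mean
  is \<open>10\<close>.
\<close>

lemma risk_mean_le:
  assumes n: "n \<ge> 1" and \<mu>: "\<mu> \<in> K n"
  shows "risk n (mean_vec n) \<mu> \<le> 10"
proof -
  obtain r :: real where r: "r \<ge> 1" "real n = r ^ 4" "real n powr (- 1/4) = 1 / r"
    "real n powr (- 1/2) = 1 / r\<^sup>2"
    using fourth_root[OF n] by metis
  obtain \<alpha> where \<alpha>: "0 \<le> \<alpha>" "\<alpha> \<le> 1" "\<And>i. i < n \<Longrightarrow> \<bar>\<mu> i - \<alpha> / r\<bar> \<le> \<alpha> / r\<^sup>2"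
    using K_deviation[OF n r(1,3,4) \<mu>] by metis
  have dev: "\<bar>\<mu> i - \<alpha> / r\<bar> \<le> 1 / r\<^sup>2" if "i < n" for i
    using \<alpha>(3)[OF that] \<alpha>(1,2) r(1) by (smt (verit) divide_right_mono zero_le_power2)
  define m where "m = (\<Sum>i<n. \<mu> i) / n"
  have "\<bar>m - \<alpha> / r\<bar> = \<bar>\<Sum>i<n. \<mu> i - \<alpha> / r\<bar> / n"
    using n by (simp add: m_def sum_subtractf field_simps)
  also have "\<dots> \<le> (n * (1 / r\<^sup>2)) / n"
    using sum_bounded_above[of "{..<n}" "\<lambda>i. \<bar>\<mu> i - \<alpha> / r\<bar>" "1 / r\<^sup>2"] dev
    by (intro divide_right_mono order_trans[OF sum_abs]) auto
  finally have m: "\<bar>m - \<alpha> / r\<bar> \<le> 1 / r\<^sup>2" using n by simp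
  have bound: "(vnorm n (vdiff n (mean_vec n (vadd n z \<mu>)) \<mu>))\<^sup>2 \<le> 2 / n * (\<Sum>i<n. z i)\<^sup>2 + 8" for z
  proof -
    define S where "S = (\<Sum>i<n. z i)"
    have mean: "(\<Sum>j<n. vadd n z \<mu> j) / n = S / n + m"
      by (simp add: vadd_def S_def m_def sum.distrib add_divide_distrib)
    have "(S / n + m - \<mu> i)\<^sup>2 \<le> 2 * (S / n)\<^sup>2 + 8 / n" if "i < n" for i
    proof -
      have "\<bar>m - \<mu> i\<bar> \<le> 2 / r\<^sup>2" using m dev[OF that] by auto
      then have "(m - \<mu> i)\<^sup>2 \<le> (2 / r\<^sup>2)\<^sup>2" by (metis abs_ge_zero power2_abs power_mono)
      also have "\<dots> = 4 / n" using r by (simp add: power_divide)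
      finally have "(m - \<mu> i)\<^sup>2 \<le> 4 / n" .
      moreover have "(S / n + (m - \<mu> i))\<^sup>2 \<le> 2 * (S / n)\<^sup>2 + 2 * (m - \<mu> i)\<^sup>2"
        using sum_squares_bound[of "S / n" "m - \<mu> i"] by (simp only: power2_sum) 
      ultimately show ?thesis by (simp add: add_diff_eq)
    qed
    then have "(\<Sum>i<n. (S / n + m - \<mu> i)\<^sup>2) \<le> n * (2 * (S / n)\<^sup>2 + 8 / n)"
      using sum_bounded_above[of "{..<n}" "\<lambda>i. (S / n + m - \<mu> i)\<^sup>2" "2 * (S / n)\<^sup>2 + 8 / n"] by simp
    also have "\<dots> = 2 / n * S\<^sup>2 + 8"
      using n by (simp add: power_divide power2_eq_square field_simps)
    finally show ?thesis
      by (simp add: vnorm_power2 vdiff_def mean_vec_def mean S_def)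
  qed
  have int: "integrable (std_gaussian n) (\<lambda>z. 2 / n * (\<Sum>i<n. z i)\<^sup>2 + 8)"
    by (intro Bochner_Integration.integrable_add integrable_mult_right std_gaussian_sum
      finite_measure.integrable_const prob_space.finite_measure prob_space_std_gaussian)
  have "risk n (mean_vec n) \<mu> \<le> (\<integral>\<^sup>+z. ennreal (2 / n * (\<Sum>i<n. z i)\<^sup>2 + 8) \<partial>std_gaussian n)"
    unfolding risk_def by (intro nn_integral_mono ennreal_leI bound)
  also have "\<dots> = ennreal (\<integral>z. 2 / n * (\<Sum>i<n. z i)\<^sup>2 + 8 \<partial>std_gaussian n)"
    by (intro nn_integral_eq_integral int) auto
  also have "(\<integral>z. 2 / n * (\<Sum>i<n. z i)\<^sup>2 + 8 \<partial>std_gaussian n) = 10"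
    using n by (subst Bochner_Integration.integral_add)
      (auto simp: std_gaussian_sum prob_space.prob_space[OF prob_space_std_gaussian]
        intro!: finite_measure.integrable_const prob_space.finite_measure prob_space_std_gaussian)
  finally show ?thesis by simp
qed

section \<open>The risk of the projection\<close>

lemma inner_le_AM_GM:
  fixes p v :: "'a \<Rightarrow> real"
  shows "2 * l * (\<Sum>i\<in>I. p i * v i) \<le> (\<Sum>i\<in>I. (p i)\<^sup>2) + l\<^sup>2 * (\<Sum>i\<in>I. (v i)\<^sup>2)"
proof -
  have "0 \<le> (\<Sum>i\<in>I. (p i - l * v i)\<^sup>2)" by (simp add: sum_nonneg)
  also have "\<dots> = (\<Sum>i\<in>I. (p i)\<^sup>2 - 2 * l * (p i * v i) + l\<^sup>2 * (v i)\<^sup>2)"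
    by (intro sum.cong refl) (simp add: power2_eq_square algebra_simps)
  also have "\<dots> = (\<Sum>i\<in>I. (p i)\<^sup>2) - 2 * l * (\<Sum>i\<in>I. p i * v i) + l\<^sup>2 * (\<Sum>i\<in>I. (v i)\<^sup>2)"
    by (simp add: sum.distrib sum_subtractf sum_distrib_left)
  finally show ?thesis by simp
qed

text \<open>
  The left side is \<open>2 l X - l\<^sup>2 D\<close>, where \<open>X = \<langle>z, w\<rangle>\<close> is the support function of the part of \<open>K\<close>
  with \<open>\<alpha> = 1\<close>, evaluated at \<open>z\<close>. It is enough to find a vector \<open>v\<close> with \<open>X \<le> \<langle>p, v\<rangle>\<close> and
  \<open>\<parallel>v\<parallel>\<^sup>2 \<le> D\<close>, because of \<open>inner_le_AM_GM\<close>. The quantity \<open>D\<close> is chosen so that a single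
  expression dominates \<open>\<parallel>v\<parallel>\<^sup>2\<close> for both small and large \<open>r\<close>.
\<close>

lemma projection_norm_lower_bound:
  fixes r l :: real
  assumes n: "n \<ge> 1" and r: "r \<ge> 1" "real n = r ^ 4"
    "real n powr (- 1/4) = 1 / r" "real n powr (- 1/2) = 1 / r\<^sup>2"
    and l: "l \<ge> 0" and p: "p = proj_Rn n (K n) z"
  shows "2 * l * ((\<Sum>i<n. z i) / r + (\<Sum>i<n. \<bar>z i\<bar>) / r\<^sup>2)
      - l\<^sup>2 * (8 * r\<^sup>2 + 16 / r\<^sup>2 * ((\<Sum>i<n. z i)\<^sup>2 / r\<^sup>2 + (\<Sum>i<n. (z i)\<^sup>2)))
    \<le> (\<Sum>i<n. (p i)\<^sup>2)"
    (is "2 * l * ?X - l\<^sup>2 * ?D \<le> _")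
proof -
  define S where "S = (\<Sum>i<n. z i)"
  define T where "T = (\<Sum>i<n. \<bar>z i\<bar>)"
  define Q where "Q = (\<Sum>i<n. (z i)\<^sup>2)"
  define w where "w = (\<lambda>i\<in>{..<n}. 1 / r + (if z i \<ge> 0 then 1 else -1) / r\<^sup>2)"
  have X: "?X = S / r + T / r\<^sup>2" and D: "?D = 8 * r\<^sup>2 + 16 / r\<^sup>2 * (S\<^sup>2 / r\<^sup>2 + Q)"
    by (simp_all add: S_def T_def Q_def)
  have w: "w \<in> K n"
    unfolding K_def r(3,4) Rn_def
    by (auto simp: w_def intro!: bexI[of _ 1] exI[of _ "\<lambda>i. if z i \<ge> 0 then 1 else -1 :: real"])
  have r2: "1 / r\<^sup>2 \<le> 1 / r" using r(1) by (simp add: field_simps power2_eq_square)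
  have "(w i)\<^sup>2 \<le> (2 / r)\<^sup>2" if "i < n" for i
  proof (rule power_mono)
    have "2 / r = 2 * (1 / r)" "0 \<le> 1 / r\<^sup>2" using r(1) by auto
    moreover have "w i = 1 / r + 1 / r\<^sup>2 \<or> w i = 1 / r - 1 / r\<^sup>2" using that by (simp add: w_def)
    ultimately show "w i \<le> 2 / r" "0 \<le> w i" using r2 by linarith+
  qed
  then have "(\<Sum>i<n. (w i)\<^sup>2) \<le> n * (2 / r)\<^sup>2"
    using sum_bounded_above[of "{..<n}" "\<lambda>i. (w i)\<^sup>2" "(2 / r)\<^sup>2"] by simp
  also have "\<dots> = 4 * r\<^sup>2" using r(1) unfolding r(2) by (simp add: field_simps power2_eq_square power4_eq_xxxx)
  finally have w2: "(\<Sum>i<n. (w i)\<^sup>2) \<le> 4 * r\<^sup>2" .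
  have zw: "z i * w i = z i / r + \<bar>z i\<bar> / r\<^sup>2" if "i < n" for i
    using that by (simp add: w_def field_simps)
  have zw': "(\<Sum>i<n. z i * w i) = ?X"
    by (simp add: zw sum.distrib sum_divide_distrib)
  note proj = proj_Rn_variational[OF compact_K[OF n] _ convex_K[OF n], where y = z, folded p]
  have pK: "p \<in> K n" using proj(1) w by blast
  have "0 \<ge> (\<Sum>i<n. (z i - p i) * (w i - p i))"
    using proj(2)[where q = w] w by blast
  also have "(\<Sum>i<n. (z i - p i) * (w i - p i)) = (\<Sum>i<n. z i * w i - z i * p i - p i * w i + (p i)\<^sup>2)"
    by (intro sum.cong refl) (simp add: power2_eq_square algebra_simps)
  also have "\<dots> = ?X - (\<Sum>i<n. z i * p i) - (\<Sum>i<n. p i * w i) + (\<Sum>i<n. (p i)\<^sup>2)"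
    by (simp only: sum.distrib sum_subtractf zw')
  finally have VI: "?X \<le> (\<Sum>i<n. z i * p i) + (\<Sum>i<n. p i * w i)"
    using sum_nonneg[of "{..<n}" "\<lambda>i. (p i)\<^sup>2"] by simp
  have sq2: "(x + y)\<^sup>2 \<le> 2 * x\<^sup>2 + 2 * y\<^sup>2" for x y :: real
    using sum_squares_bound[of x y] by (simp only: power2_sum)
  have Q0: "Q \<ge> 0" by (simp add: Q_def sum_nonneg)
  have D0: "?D \<ge> 0" unfolding D using Q0 by simp
  have main: "2 * l * ?X - l\<^sup>2 * ?D \<le> (\<Sum>i<n. (p i)\<^sup>2)"
    if v: "?X \<le> (\<Sum>i<n. p i * v i)" "(\<Sum>i<n. (v i)\<^sup>2) \<le> ?D" for v
  proof -
    have "2 * l * ?X \<le> 2 * l * (\<Sum>i<n. p i * v i)"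
      using v l by (intro mult_left_mono) auto
    also have "\<dots> \<le> (\<Sum>i<n. (p i)\<^sup>2) + l\<^sup>2 * (\<Sum>i<n. (v i)\<^sup>2)" by (rule inner_le_AM_GM)
    also have "\<dots> \<le> (\<Sum>i<n. (p i)\<^sup>2) + l\<^sup>2 * ?D"
      using v by (intro add_left_mono mult_left_mono) auto
    finally show ?thesis by simp
  qed
  \<comment> \<open>For \<open>r\<close> close to \<open>1\<close> the coordinates of \<open>p\<close> can be close to \<open>0\<close> although \<open>\<alpha>\<close> is large, so \<open>p\<close>
    does not control \<open>\<alpha>\<close>. There \<open>n\<close> is bounded, and the crude \<open>v = z + w\<close> is short enough.\<close>
  consider "r < 2" | "?X < 0" | "r \<ge> 2" "?X \<ge> 0" by linarith
  then show ?thesis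
  proof cases
    case 1
    show ?thesis
    proof (rule main)
      show "?X \<le> (\<Sum>i<n. p i * (z i + w i))"
        using VI by (simp add: algebra_simps sum.distrib)
      have "(\<Sum>i<n. (z i + w i)\<^sup>2) \<le> (\<Sum>i<n. 2 * (z i)\<^sup>2 + 2 * (w i)\<^sup>2)"
        by (intro sum_mono sq2)
      also have "\<dots> = 2 * Q + 2 * (\<Sum>i<n. (w i)\<^sup>2)"
        by (simp add: Q_def sum.distrib sum_distrib_left)
      also have "\<dots> \<le> 2 * Q + 8 * r\<^sup>2" using w2 by simp
      also have "2 * Q \<le> 16 / r\<^sup>2 * Q"
      proof (rule mult_right_mono[OF _ Q0])
        have "r\<^sup>2 \<le> 2\<^sup>2" using 1 r(1) by (intro power_mono) auto
        then show "2 \<le> 16 / r\<^sup>2" using r(1) by (simp add: field_simps)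
      qed
      also have "16 / r\<^sup>2 * Q + 8 * r\<^sup>2 \<le> ?D"
        unfolding D by (simp add: algebra_simps)
      finally show "(\<Sum>i<n. (z i + w i)\<^sup>2) \<le> ?D" by simp
    qed
  next
    case 2
    have "2 * l * ?X \<le> 0" using 2 l by (simp add: mult_nonneg_nonpos)
    moreover have "0 \<le> l\<^sup>2 * ?D" using D0 by simp
    moreover have "0 \<le> (\<Sum>i<n. (p i)\<^sup>2)" by (simp add: sum_nonneg)
    ultimately show ?thesis by linarith
  next
    case 3
    obtain \<alpha> where \<alpha>: "0 \<le> \<alpha>" "\<alpha> \<le> 1" "\<And>i. i < n \<Longrightarrow> \<bar>p i - \<alpha> / r\<bar> \<le> \<alpha> / r\<^sup>2"
      using K_deviation[OF n r(1,3,4) pK] by metis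
    \<comment> \<open>Among the points of \<open>K\<close> with parameter \<open>\<alpha>\<close>, the point \<open>\<alpha> w\<close> correlates best with \<open>z\<close>.\<close>
    have "z i * p i \<le> \<alpha> * (z i * w i)" if "i < n" for i
    proof -
      have "z i * (p i - \<alpha> / r) \<le> \<bar>z i\<bar> * \<bar>p i - \<alpha> / r\<bar>"
        unfolding abs_mult[symmetric] by (rule abs_ge_self)
      also have "\<dots> \<le> \<bar>z i\<bar> * (\<alpha> / r\<^sup>2)"
        using \<alpha>(3)[OF that] by (intro mult_left_mono) auto
      finally show ?thesis using zw[OF that] by (simp add: algebra_simps)
    qed
    then have "(\<Sum>i<n. z i * p i) \<le> (\<Sum>i<n. \<alpha> * (z i * w i))" by (intro sum_mono) auto
    then have zp: "(\<Sum>i<n. z i * p i) \<le> \<alpha> * ?X" by (simp only: sum_distrib_left[symmetric] zw')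
    \<comment> \<open>For \<open>r \<ge> 2\<close> the variation \<open>\<alpha>/r\<^sup>2\<close> is at most half of the level \<open>\<alpha>/r\<close>.\<close>
    have "\<alpha> / (2 * r) \<le> p i" if "i < n" for i
    proof -
      have "\<alpha> / r\<^sup>2 \<le> \<alpha> / (2 * r)"
        using 3 \<alpha>(1) by (intro divide_left_mono) (auto simp: power2_eq_square)
      moreover have "\<alpha> / r = 2 * (\<alpha> / (2 * r))" by simp
      ultimately show ?thesis using \<alpha>(3)[OF that] by linarith
    qed
    then have "n * (\<alpha> / (2 * r)) \<le> (\<Sum>i<n. p i)"
      using sum_bounded_below[of "{..<n}" "\<alpha> / (2 * r)" p] by simp
    then have \<alpha>p: "\<alpha> \<le> 2 / r ^ 3 * (\<Sum>i<n. p i)"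
      using r(1) unfolding r(2) by (simp add: field_simps power4_eq_xxxx power3_eq_cube)
    \<comment> \<open>With this bound on \<open>\<alpha>\<close>, the term \<open>\<alpha> X\<close> is at most the inner product of \<open>p\<close> with the constant
      vector \<open>c\<close>.\<close>
    define c where "c = 2 * ?X / r ^ 3"
    show ?thesis
    proof (rule main)
      have "\<alpha> * ?X \<le> (2 / r ^ 3 * (\<Sum>i<n. p i)) * ?X"
        using \<alpha>p 3 by (intro mult_right_mono) auto
      also have "\<dots> = (\<Sum>i<n. p i) * c" by (simp add: c_def)
      finally show "?X \<le> (\<Sum>i<n. p i * (w i + c))"
        using VI zp by (simp add: distrib_left sum.distrib sum_distrib_right)
      have T2: "T\<^sup>2 \<le> r ^ 4 * Q"
        using Cauchy_Schwarz_ineq_sum[of "\<lambda>_. 1" "\<lambda>i. \<bar>z i\<bar>" "{..<n}"]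
        by (simp add: T_def Q_def r(2))
      have "?X\<^sup>2 \<le> 2 * (S / r)\<^sup>2 + 2 * (T / r\<^sup>2)\<^sup>2" unfolding X by (rule sq2)
      also have "(T / r\<^sup>2)\<^sup>2 \<le> Q" using T2 r(1) by (simp add: power_divide field_simps)
      finally have X2: "?X\<^sup>2 \<le> 2 * (S\<^sup>2 / r\<^sup>2 + Q)" by (simp add: power_divide)
      have "(\<Sum>i<n. (w i + c)\<^sup>2) \<le> (\<Sum>i<n. 2 * (w i)\<^sup>2 + 2 * c\<^sup>2)"
        by (intro sum_mono sq2)
      also have "\<dots> = 2 * (\<Sum>i<n. (w i)\<^sup>2) + r ^ 4 * (2 * c\<^sup>2)"
        by (simp add: sum.distrib sum_distrib_left r(2))
      also have "r ^ 4 * (2 * c\<^sup>2) = 8 / r\<^sup>2 * ?X\<^sup>2"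
      proof -
        have "r ^ 4 * (2 * (2 * x / r ^ 3)\<^sup>2) = 8 / r\<^sup>2 * x\<^sup>2" for x
          using r(1) by (simp add: power_divide eval_nat_numeral)
        then show ?thesis unfolding c_def .
      qed
      also have "\<dots> \<le> 8 / r\<^sup>2 * (2 * (S\<^sup>2 / r\<^sup>2 + Q))"
        using X2 by (intro mult_left_mono) auto
      also have "2 * (\<Sum>i<n. (w i)\<^sup>2) + 8 / r\<^sup>2 * (2 * (S\<^sup>2 / r\<^sup>2 + Q)) \<le> ?D"
        unfolding D using w2 by simp
      finally show "(\<Sum>i<n. (w i + c)\<^sup>2) \<le> ?D" by simp
    qed
  qed
qed

text \<open>
  Integrating \<open>projection_norm_lower_bound\<close>: the mean of \<open>X\<close> is \<open>sqrt (2/\<pi>) r\<^sup>2 \<ge> r\<^sup>2/2\<close>, and the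
  mean of \<open>D\<close> is \<open>24 r\<^sup>2 + 16 \<le> 40 r\<^sup>2\<close>. The resulting lower bound \<open>(l - 40 l\<^sup>2) r\<^sup>2\<close> is largest
  at \<open>l = 1/80\<close>, with value \<open>r\<^sup>2/160\<close>.
\<close>

lemma risk_proj_at_origin_ge:
  assumes n: "n \<ge> 1"
  shows "ennreal (1 / 160 * real n powr (1/2)) \<le> risk n (proj_Rn n (K n)) (\<lambda>i\<in>{..<n}. 0)"
proof -
  obtain r :: real where r: "r \<ge> 1" "real n = r ^ 4" "real n powr (- 1/4) = 1 / r"
    "real n powr (- 1/2) = 1 / r\<^sup>2" and rn: "real n powr (1/2) = r\<^sup>2"
    using fourth_root[OF n] by metis
  define l :: real where "l = 1 / 80"
  define g where "g = (\<lambda>z. 2 * l * ((\<Sum>i<n. z i) / r + (\<Sum>i<n. \<bar>z i\<bar>) / r\<^sup>2)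
      - l\<^sup>2 * (8 * r\<^sup>2 + 16 / r\<^sup>2 * ((\<Sum>i<n. z i)\<^sup>2 / r\<^sup>2 + (\<Sum>i<n. (z i)\<^sup>2))))"
  interpret prob_space "std_gaussian n" by (rule prob_space_std_gaussian)
  note [simp] = std_gaussian_sum
  have int: "integrable (std_gaussian n) g" by (simp add: g_def)
  have pi2: "1 / 2 \<le> sqrt (2 / pi)"
    using pi_less_4 by (intro real_le_rsqrt) (simp add: power2_eq_square field_simps)
  have r2: "1 \<le> r\<^sup>2" using r(1) by simp
  have "(\<integral>z. g z \<partial>std_gaussian n) = 2 * l * (r ^ 4 * sqrt (2 / pi) / r\<^sup>2)
      - l\<^sup>2 * (8 * r\<^sup>2 + 16 / r\<^sup>2 * (r ^ 4 / r\<^sup>2 + r ^ 4))"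
    by (simp add: g_def prob_space r(2))
  also have "\<dots> = 2 * l * r\<^sup>2 * sqrt (2 / pi) - l\<^sup>2 * (8 * r\<^sup>2 + 16 + 16 * r\<^sup>2)"
    using r(1) by (simp add: field_simps power2_eq_square power4_eq_xxxx)
  also have "\<dots> \<ge> 2 * l * r\<^sup>2 * (1 / 2) - l\<^sup>2 * (40 * r\<^sup>2)"
    using pi2 r2 by (intro diff_mono mult_left_mono) (auto simp: l_def)
  also have "2 * l * r\<^sup>2 * (1 / 2) - l\<^sup>2 * (40 * r\<^sup>2) = 1 / 160 * r\<^sup>2"
    by (simp add: l_def power2_eq_square)
  finally have "ennreal (1 / 160 * r\<^sup>2) \<le> ennreal (\<integral>z. g z \<partial>std_gaussian n)"
    by (rule ennreal_leI)
  also have "\<dots> \<le> risk n (proj_Rn n (K n)) (\<lambda>i\<in>{..<n}. 0)"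
    unfolding risk_def
  proof (rule ennreal_integral_le_nn_integral[OF int])
    fix z
    define y where "y = vadd n z (\<lambda>i\<in>{..<n}. 0)"
    have y: "y i = z i" if "i < n" for i using that by (simp add: y_def vadd_def)
    have "g z = g y" by (simp add: g_def y)
    also have "\<dots> \<le> (\<Sum>i<n. (proj_Rn n (K n) y i)\<^sup>2)"
      unfolding g_def by (rule projection_norm_lower_bound[OF n r]) (auto simp: l_def)
    also have "\<dots> = (vnorm n (vdiff n (proj_Rn n (K n) y) (\<lambda>i\<in>{..<n}. 0)))\<^sup>2"
      by (simp add: vnorm_power2 vdiff_def)
    finally show "g z \<le> (vnorm n (vdiff n (proj_Rn n (K n) (vadd n z (\<lambda>i\<in>{..<n}. 0))) (\<lambda>i\<in>{..<n}. 0)))\<^sup>2"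
      by (simp add: y_def)
  qed
  finally show ?thesis by (simp only: rn)
qed

theorem proposition1p5:
  "(\<forall>n\<ge>1. closed_Rn n (K n) \<and> convex_Rn n (K n)) \<and>
   (\<exists>C1>0. \<exists>C2>0. \<forall>n\<ge>1.
      (\<Squnion>\<mu>\<in>K n. risk n (proj_Rn n (K n)) \<mu>) \<ge> ennreal (C1 * real n powr (1/2)) \<and>
      (\<Squnion>\<mu>\<in>K n. risk n (mean_vec n) \<mu>) \<le> ennreal C2)"
proof (rule conjI)
  show "\<forall>n\<ge>1. closed_Rn n (K n) \<and> convex_Rn n (K n)"
    using closed_K convex_K by blast
  have "(\<Squnion>\<mu>\<in>K n. risk n (proj_Rn n (K n)) \<mu>) \<ge> ennreal (1 / 160 * real n powr (1/2)) \<and>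
      (\<Squnion>\<mu>\<in>K n. risk n (mean_vec n) \<mu>) \<le> ennreal 10" if n: "n \<ge> 1" for n
  proof
    have "(\<lambda>i\<in>{..<n}. 0) \<in> K n"
      by (auto simp: K_def Rn_def intro!: bexI[of _ 0])
    from order_trans[OF risk_proj_at_origin_ge[OF n] SUP_upper[where f = "risk n (proj_Rn n (K n))", OF this]]
    show "(\<Squnion>\<mu>\<in>K n. risk n (proj_Rn n (K n)) \<mu>) \<ge> ennreal (1 / 160 * real n powr (1/2))" .
    show "(\<Squnion>\<mu>\<in>K n. risk n (mean_vec n) \<mu>) \<le> ennreal 10"
      using risk_mean_le[OF n] by (intro SUP_least) simp
  qed
  note bounds = this
  show "\<exists>C1>0. \<exists>C2>0. \<forall>n\<ge>1.
      (\<Squnion>\<mu>\<in>K n. risk n (proj_Rn n (K n)) \<mu>) \<ge> ennreal (C1 * real n powr (1/2)) \<and>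
      (\<Squnion>\<mu>\<in>K n. risk n (mean_vec n) \<mu>) \<le> ennreal C2"
  proof (intro exI conjI)
    show "(0::real) < 1 / 160" "(0::real) < 10" by simp_all
  qed (use bounds in blast)
qed

end
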